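(* For any $f,g\in L^2(\mathbb R)$ and $\alpha,\beta,k\in\mathbb R$, $\mu\in\mathbb R^+$, the continuous special affine wavelet transform satisfies the following properties: (1) Linearity: $\mathcal W_{\mathbf M}^{\psi}[\alpha f+\beta g](b,a)=\alpha\,\mathcal W_{\mathbf M}^{\psi}[f](b,a)+\beta\,\mathcal W_{\mathbf M}^{\psi}[g](b,a)$. (2) Translation: $\mathcal W_{\mathbf M}^{\psi}[f(t-k)](b,a)=\exp\left\{-i\frac{A}{2B}\left(\frac{2bk}{a}-\left(1+\frac1{a^2}\right)k^2\right)\right\}\,\mathcal W_{\mathbf M}^{\psi}\left[\exp\left\{i\frac{A}{B}tk\right\}f(t)\right](b-k,a)$. (3) Scaling: $\mathcal W_{\mathbf M}^{\psi}[f(\mu t)](b,a)=\frac{1}{\mu}\,\mathcal W_{\mathbf M}^{\psi}\left[\exp\left\{-i\frac{A}{2B}t^2\left(1-\frac1{\mu^2}\right)\right\}f(t)\right](\mu b,\mu a)$.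
   Context: Fix real parameters $A,B,C,D,p,q$ with $AD-BC=1$ and $B\neq0$, and write $\mathbf M=(A,B,C,D:p,q)$. For a wavelet $\psi\in L^2(\mathbb R)$, $b\in\mathbb R$ and $a\in\mathbb R^+=(0,\infty)$ put $$\psi^{\mathbf M}_{b,a}(t)=\frac{1}{\sqrt{i2\pi aB}}\,\psi\left(\frac{t-b}{a}\right)\exp\left\{-\frac{i}{2B}\left(At^2+Dp^2-A\left(\frac ba\right)^2\right)\right\}.$$ The continuous special affine wavelet transform of $f\in L^2(\mathbb R)$ with respect to $\psi$ is $\mathcal W_{\mathbf M}^{\psi}[f](b,a)=\int_{\mathbb R}f(t)\,\overline{\psi^{\mathbf M}_{b,a}(t)}\,dt$. In $\mathcal W_{\mathbf M}^\psi[h(t)]$ the argument is the function $t\mapsto h(t)$.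
   Formalization: Two printed factors are false for the given definition and are corrected: in (2) the phase term 2bk/a is replaced by 2bk/a², and in (3) the factor 1/μ is replaced by 1/√μ. *)

theory Defs
  imports "HOL-Analysis.Analysis"
begin

text \<open>Representatives of elements of \<open>L\<^sup>2(\<real>)\<close>: complex-valued Lebesgue measurable functions
  with integrable squared modulus. The integral transform below does not
  depend on the choice of representative.\<close>

definition in_L2 :: "(real \<Rightarrow> complex) \<Rightarrow> bool" where
  "in_L2 f \<longleftrightarrow> f \<in> borel_measurable lebesgue \<and> integrable lebesgue (\<lambda>t. (cmod (f t))\<^sup>2)"

text \<open>The parameters \<open>A B C D p q\<close> are the entries of the matrix \<open>\<^bold>M = (A,B,C,D : p,q)\<close>. The atoms do
  not depend on \<open>C\<close> and \<open>q\<close>; these are kept so that the transform is indexed by all of \<open>\<^bold>M\<close>.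
  The square root of the imaginary number \<open>2\<pi>iaB\<close> is the principal one.\<close>

definition sa_atom ::
  "real \<Rightarrow> real \<Rightarrow> real \<Rightarrow> real \<Rightarrow> real \<Rightarrow> real \<Rightarrow> (real \<Rightarrow> complex) \<Rightarrow> real \<Rightarrow> real \<Rightarrow> real \<Rightarrow> complex"
where
  "sa_atom A B C D p q \<psi> b a t =
     1 / csqrt (\<i> * of_real (2 * pi * a * B)) * \<psi> ((t - b) / a) *
     exp (- (\<i> / of_real (2 * B)) * of_real (A * t\<^sup>2 + D * p\<^sup>2 - A * (b / a)\<^sup>2))"

definition sa_wavelet_transform ::
  "real \<Rightarrow> real \<Rightarrow> real \<Rightarrow> real \<Rightarrow> real \<Rightarrow> real \<Rightarrow> (real \<Rightarrow> complex) \<Rightarrow> (real \<Rightarrow> complex) \<Rightarrow> real \<Rightarrow> real \<Rightarrow> complex"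
where
  "sa_wavelet_transform A B C D p q \<psi> f b a =
     integral\<^sup>L lebesgue (\<lambda>t. f t * cnj (sa_atom A B C D p q \<psi> b a t))"

end

theory Submission
  imports Defs
begin

text \<open>
  Up to a normalising constant and a factor of modulus one, the atom at \<open>(b, a)\<close> is the wavelet
  \<open>t \<mapsto> \<psi> ((t - b) / a)\<close>. Affine substitutions and bounded factors preserve
  \<open>L\<^sup>2(\<real>)\<close>, so the atom lies in \<open>L\<^sup>2(\<real>)\<close>, every integral defining a transform
  converges absolutely, and linearity is linearity of the integral.

  Translation and scaling are changes of variable. Moving \<open>t\<close> to \<open>t + k\<close> or to \<open>t / \<mu>\<close>
  turns the argument \<open>(t - b) / a\<close> of the wavelet into the one belonging to \<open>(b - k, a)\<close> or
  \<open>(\<mu> b, \<mu> a)\<close>, and changes the quadratic phase by a chirp. The identities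
  \<open>sa_atom_shift\<close> and \<open>sa_atom_rescale\<close> isolate this chirp. For the shift it splits into the
  modulation \<open>2 t k\<close> under the integral and a constant. For the scaling it comes from the difference of
  \<open>t\<^sup>2\<close> and \<open>(t / \<mu>)\<^sup>2\<close>. The Jacobian contributes \<open>1 / \<mu>\<close>, while the
  normalising constants of the two atoms differ by the factor \<open>sqrt \<mu>\<close>, which leaves \<open>1 / sqrt \<mu>\<close>.
\<close>

lemma in_L2_affine:
  assumes "in_L2 f" and "c \<noteq> 0"
  shows "in_L2 (\<lambda>t. f (s + c * t))"
proof -
  have "(\<lambda>t::real. s + c * t) \<in> lebesgue \<rightarrow>\<^sub>M lebesgue"
    using lebesgue_affine_measurable[where c = "\<lambda>_::real. c" and t = s] assms(2) by simp
  then have "(\<lambda>t. f (s + c * t)) \<in> borel_measurable lebesgue"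
    using assms(1) measurable_compose unfolding in_L2_def by blast
  then show ?thesis
    using assms lebesgue_integrable_real_affine[of "\<lambda>t. (cmod (f t))\<^sup>2" c s]
    by (simp add: in_L2_def)
qed

lemma in_L2_bounded_mult:
  assumes f: "in_L2 f" and h: "h \<in> borel_measurable lebesgue"
    and K: "\<And>t. cmod (h t) \<le> K"
  shows "in_L2 (\<lambda>t. h t * f t)"
proof -
  have [measurable]: "f \<in> borel_measurable lebesgue" "h \<in> borel_measurable lebesgue"
    using f h by (auto simp: in_L2_def)
  have "integrable lebesgue (\<lambda>t. K\<^sup>2 * (cmod (f t))\<^sup>2)"
    using f by (simp add: in_L2_def)
  then have "integrable lebesgue (\<lambda>t. (cmod (h t * f t))\<^sup>2)"
    by (rule Bochner_Integration.integrable_bound)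
       (auto simp: norm_mult power_mult_distrib intro!: mult_right_mono power_mono K)
  then show ?thesis
    by (simp add: in_L2_def)
qed

lemma integrable_mult_cnj_in_L2:
  assumes "in_L2 f" and "in_L2 g"
  shows "integrable lebesgue (\<lambda>t. f t * cnj (g t))"
proof -
  have [measurable]: "f \<in> borel_measurable lebesgue" "g \<in> borel_measurable lebesgue"
    using assms by (auto simp: in_L2_def)
  have "(\<lambda>t. cnj (g t)) \<in> borel_measurable lebesgue"
    by (rule borel_measurable_continuous_on[of cnj]) (auto intro!: continuous_intros)
  then have meas: "(\<lambda>t. f t * cnj (g t)) \<in> borel_measurable lebesgue"
    by measurable
  have bound: "x * y \<le> x\<^sup>2 + y\<^sup>2" if "x \<ge> 0" "y \<ge> 0" for x y :: real
    using sum_squares_bound[of x y] mult_nonneg_nonneg[OF that] by linarith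
  have "integrable lebesgue (\<lambda>t. (cmod (f t))\<^sup>2 + (cmod (g t))\<^sup>2)"
    using assms by (simp add: in_L2_def)
  then show ?thesis
    by (rule Bochner_Integration.integrable_bound[OF _ meas])
       (auto simp: norm_mult intro!: bound)
qed

text \<open>Writing the exponential as \<open>cis\<close> of a real phase reduces each identity between atoms to a
  real rational identity between phases.\<close>

lemma sa_atom_cis:
  "sa_atom A B C D p q \<psi> b a t =
     1 / csqrt (\<i> * of_real (2 * pi * a * B)) * \<psi> ((t - b) / a) *
     cis (- (A * t\<^sup>2 + D * p\<^sup>2 - A * (b / a)\<^sup>2) / (2 * B))"
proof -
  have "- (\<i> / of_real (2 * B)) * of_real x = \<i> * of_real (- x / (2 * B))" for x
    by simp
  then show ?thesis
    by (simp only: sa_atom_def cis_conv_exp)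
qed

lemma in_L2_sa_atom:
  assumes "in_L2 \<psi>" and "a \<noteq> 0"
  shows "in_L2 (sa_atom A B C D p q \<psi> b a)"
proof -
  define c where "c = 1 / csqrt (\<i> * of_real (2 * pi * a * B))"
  define h where "h t = c * cis (- (A * t\<^sup>2 + D * p\<^sup>2 - A * (b / a)\<^sup>2) / (2 * B))" for t
  have "h \<in> borel_measurable borel"
    unfolding h_def divide_inverse by (intro borel_measurable_continuous_onI continuous_intros)
  then have "h \<in> borel_measurable lebesgue"
    by (intro measurable_completion) simp
  moreover have "cmod (h t) \<le> cmod c" for t
    by (simp add: h_def norm_mult)
  moreover have "in_L2 (\<lambda>t. \<psi> (- b / a + 1 / a * t))"
    using assms by (intro in_L2_affine) auto
  ultimately have "in_L2 (\<lambda>t. h t * \<psi> (- b / a + 1 / a * t))"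
    using in_L2_bounded_mult by blast
  moreover have "sa_atom A B C D p q \<psi> b a = (\<lambda>t. h t * \<psi> (- b / a + 1 / a * t))"
    by (rule ext) (simp add: sa_atom_cis h_def c_def diff_divide_distrib)
  ultimately show ?thesis
    by simp
qed

lemma sa_wavelet_transform_linear:
  assumes "in_L2 \<psi>" and "a \<noteq> 0" and "in_L2 f" and "in_L2 g"
  shows "sa_wavelet_transform A B C D p q \<psi> (\<lambda>t. u * f t + v * g t) b a =
    u * sa_wavelet_transform A B C D p q \<psi> f b a + v * sa_wavelet_transform A B C D p q \<psi> g b a"
  using integrable_mult_cnj_in_L2[OF assms(3) in_L2_sa_atom[OF assms(1,2)]]
    integrable_mult_cnj_in_L2[OF assms(4) in_L2_sa_atom[OF assms(1,2)]]
  by (simp add: sa_wavelet_transform_def distrib_right mult.assoc)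

lemma sa_atom_shift:
  "sa_atom A B C D p q \<psi> b a (t + k) =
     cis (A / (2 * B) * (2 * b * k / a\<^sup>2 - (1 + 1 / a\<^sup>2) * k\<^sup>2)) * cis (- (A / B * t * k)) *
     sa_atom A B C D p q \<psi> (b - k) a t"
proof -
  have "- (A * (t + k)\<^sup>2 + D * p\<^sup>2 - A * (b / a)\<^sup>2) / (2 * B) =
    A / (2 * B) * (2 * b * k / a\<^sup>2 - (1 + 1 / a\<^sup>2) * k\<^sup>2) + - (A / B * t * k) +
    - (A * t\<^sup>2 + D * p\<^sup>2 - A * ((b - k) / a)\<^sup>2) / (2 * B)"
  proof -
    \<comment> \<open>With \<open>w\<close> and \<open>v\<close> in place of the inverses of \<open>a\<^sup>2\<close> and \<open>2 B\<close> the identity is polynomial.\<close>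
    have "- (A * (t + k)\<^sup>2 + D * p\<^sup>2 - A * (b\<^sup>2 * w)) * v =
        A * v * (2 * b * k * w - (1 + w) * k\<^sup>2) + - (A * (2 * v) * t * k) +
        - (A * t\<^sup>2 + D * p\<^sup>2 - A * ((b - k)\<^sup>2 * w)) * v" for v w
      by algebra
    from this[of "inverse (a\<^sup>2)" "inverse (2 * B)"] show ?thesis
      by (simp only: divide_inverse power_mult_distrib power_inverse mult_1_left)
         simp
  qed
  moreover have "(t + k - b) / a = (t - (b - k)) / a"
    by simp
  ultimately show ?thesis
    unfolding sa_atom_cis by (simp only: cis_mult[symmetric] mult_ac)
qed

text \<open>A positive factor may be extracted because it does not move its cofactor across the branch
  cut of the principal square root.\<close>

lemma csqrt_of_real_mult:
  assumes "r \<ge> 0"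
  shows "csqrt (of_real r * z) = of_real (sqrt r) * csqrt z"
proof (cases "r = 0")
  case False
  with assms have "sqrt r > 0" by simp
  then show ?thesis
    using csqrt_principal[of z] assms
    by (intro csqrt_unique) (auto simp: power_mult_distrib simp flip: of_real_power simp del: csqrt.sel)
qed simp

lemma sa_atom_rescale:
  assumes "\<mu> > 0"
  shows "sa_atom A B C D p q \<psi> b a (t / \<mu>) =
     of_real (sqrt \<mu>) * cis (A / (2 * B) * t\<^sup>2 * (1 - 1 / \<mu>\<^sup>2)) *
     sa_atom A B C D p q \<psi> (\<mu> * b) (\<mu> * a) t"
proof -
  have wavelet: "(t / \<mu> - b) / a = (t - \<mu> * b) / (\<mu> * a)"
    using assms by (simp add: diff_divide_distrib)
  have "csqrt (\<i> * of_real (2 * pi * (\<mu> * a) * B)) =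
      of_real (sqrt \<mu>) * csqrt (\<i> * of_real (2 * pi * a * B))"
    using csqrt_of_real_mult[of \<mu> "\<i> * of_real (2 * pi * a * B)"] assms
    by (simp add: mult_ac)
  then have const: "1 / csqrt (\<i> * of_real (2 * pi * a * B)) =
      of_real (sqrt \<mu>) * (1 / csqrt (\<i> * of_real (2 * pi * (\<mu> * a) * B)))"
    using assms by simp
  have phase: "- (A * (t / \<mu>)\<^sup>2 + D * p\<^sup>2 - A * (b / a)\<^sup>2) / (2 * B) =
      A / (2 * B) * t\<^sup>2 * (1 - 1 / \<mu>\<^sup>2) +
      - (A * t\<^sup>2 + D * p\<^sup>2 - A * ((\<mu> * b) / (\<mu> * a))\<^sup>2) / (2 * B)"
    using assms by (simp add: power_divide diff_divide_distrib add_divide_distrib right_diff_distrib)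
  show ?thesis
    unfolding sa_atom_cis[of _ _ _ _ _ _ _ b] sa_atom_cis[of _ _ _ _ _ _ _ "\<mu> * b"]
      wavelet const phase cis_mult[symmetric]
    by (simp only: mult_ac)
qed

lemma sa_wavelet_transform_translation:
  "sa_wavelet_transform A B C D p q \<psi> (\<lambda>t. f (t - k)) b a =
     exp (- \<i> * of_real (A / (2 * B) * (2 * b * k / a\<^sup>2 - (1 + 1 / a\<^sup>2) * k\<^sup>2))) *
     sa_wavelet_transform A B C D p q \<psi> (\<lambda>t. exp (\<i> * of_real (A / B * t * k)) * f t) (b - k) a"
proof -
  define \<theta> where "\<theta> = A / (2 * B) * (2 * b * k / a\<^sup>2 - (1 + 1 / a\<^sup>2) * k\<^sup>2)"
  have "sa_wavelet_transform A B C D p q \<psi> (\<lambda>t. f (t - k)) b a =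
      integral\<^sup>L lebesgue (\<lambda>t. f t * cnj (sa_atom A B C D p q \<psi> b a (t + k)))"
    unfolding sa_wavelet_transform_def
    by (subst lebesgue_integral_real_affine[where c = 1 and t = k]) (simp_all add: add.commute)
  also have "\<dots> = integral\<^sup>L lebesgue (\<lambda>t. cis (- \<theta>) *
      (cis (A / B * t * k) * f t * cnj (sa_atom A B C D p q \<psi> (b - k) a t)))"
    unfolding sa_atom_shift \<theta>_def[symmetric] by (simp add: cis_cnj mult_ac)
  also have "\<dots> = cis (- \<theta>) * sa_wavelet_transform A B C D p q \<psi>
      (\<lambda>t. cis (A / B * t * k) * f t) (b - k) a"
    by (simp add: sa_wavelet_transform_def)
  finally show ?thesis
    by (simp add: \<theta>_def cis_conv_exp)
qed

lemma sa_wavelet_transform_scaling: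
  assumes "\<mu> > 0"
  shows "sa_wavelet_transform A B C D p q \<psi> (\<lambda>t. f (\<mu> * t)) b a =
    1 / of_real (sqrt \<mu>) *
    sa_wavelet_transform A B C D p q \<psi>
      (\<lambda>t. exp (- \<i> * of_real (A / (2 * B) * t\<^sup>2 * (1 - 1 / \<mu>\<^sup>2))) * f t) (\<mu> * b) (\<mu> * a)"
proof -
  define \<theta> where "\<theta> t = A / (2 * B) * t\<^sup>2 * (1 - 1 / \<mu>\<^sup>2)" for t
  have jacobian: "of_real (1 / \<mu>) * of_real (sqrt \<mu>) = (1 / of_real (sqrt \<mu>) :: complex)"
    using assms by (simp add: divide_simps flip: of_real_mult)
  have "sa_wavelet_transform A B C D p q \<psi> (\<lambda>t. f (\<mu> * t)) b a =
      of_real (1 / \<mu>) * integral\<^sup>L lebesgue (\<lambda>t. f t * cnj (sa_atom A B C D p q \<psi> b a (t / \<mu>)))"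
    unfolding sa_wavelet_transform_def using assms
    by (subst lebesgue_integral_real_affine[where c = "1 / \<mu>" and t = 0])
       (simp_all add: scaleR_conv_of_real)
  also have "\<dots> = of_real (1 / \<mu>) * integral\<^sup>L lebesgue (\<lambda>t. of_real (sqrt \<mu>) *
      (cis (- \<theta> t) * f t * cnj (sa_atom A B C D p q \<psi> (\<mu> * b) (\<mu> * a) t)))"
    unfolding sa_atom_rescale[OF assms] \<theta>_def[symmetric] by (simp add: cis_cnj mult_ac)
  also have "\<dots> = of_real (1 / \<mu>) * (of_real (sqrt \<mu>) *
      sa_wavelet_transform A B C D p q \<psi> (\<lambda>t. cis (- \<theta> t) * f t) (\<mu> * b) (\<mu> * a))"
    by (simp only: sa_wavelet_transform_def Bochner_Integration.integral_mult_right_zero)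
  also have "\<dots> = 1 / of_real (sqrt \<mu>) *
      sa_wavelet_transform A B C D p q \<psi> (\<lambda>t. cis (- \<theta> t) * f t) (\<mu> * b) (\<mu> * a)"
    by (simp only: mult.assoc[symmetric] jacobian)
  finally show ?thesis
    by (simp add: \<theta>_def cis_conv_exp)
qed

theorem theorem3p1:
  fixes A B C D p q :: real and \<psi> f g :: "real \<Rightarrow> complex" and \<alpha> \<beta> k \<mu> a b :: real
  assumes "A * D - B * C = 1" and "B \<noteq> 0"
    and "in_L2 \<psi>" and "in_L2 f" and "in_L2 g" and "\<mu> > 0" and "a > 0"
  shows
    "sa_wavelet_transform A B C D p q \<psi> (\<lambda>t. of_real \<alpha> * f t + of_real \<beta> * g t) b a =
       of_real \<alpha> * sa_wavelet_transform A B C D p q \<psi> f b a +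
       of_real \<beta> * sa_wavelet_transform A B C D p q \<psi> g b a
     \<and>
     sa_wavelet_transform A B C D p q \<psi> (\<lambda>t. f (t - k)) b a =
       exp (- \<i> * of_real (A / (2 * B) * (2 * b * k / a\<^sup>2 - (1 + 1 / a\<^sup>2) * k\<^sup>2))) *
       sa_wavelet_transform A B C D p q \<psi> (\<lambda>t. exp (\<i> * of_real (A / B * t * k)) * f t) (b - k) a
     \<and>
     sa_wavelet_transform A B C D p q \<psi> (\<lambda>t. f (\<mu> * t)) b a =
       1 / of_real (sqrt \<mu>) *
       sa_wavelet_transform A B C D p q \<psi>
         (\<lambda>t. exp (- \<i> * of_real (A / (2 * B) * t\<^sup>2 * (1 - 1 / \<mu>\<^sup>2))) * f t) (\<mu> * b) (\<mu> * a)"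
proof -
  have "a \<noteq> 0"
    using assms by simp
  show ?thesis
    by (intro conjI sa_wavelet_transform_linear[OF \<open>in_L2 \<psi>\<close> \<open>a \<noteq> 0\<close> \<open>in_L2 f\<close> \<open>in_L2 g\<close>]
        sa_wavelet_transform_translation[where f = f and k = k]
        sa_wavelet_transform_scaling[where f = f, OF \<open>\<mu> > 0\<close>])
qed

end
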